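(* Let $n\ge2$. Then $N$ is a normal subgroup of $\mathrm{Sol}_{A_n}$, and $\mathrm{Sol}_{A_n}\cong N\rtimes D$.
   Context: $A_n$ is the $n\times n$ complex matrix with $(A_n)_{i,i+1}=1$ for $1\le i\le n-1$ and all other entries $0$. $\mathrm{Sol}_{A_n}=\{X\in M_n(\mathbb{C}) : X^tA_nX=A_n\}$, which is a group under matrix multiplication for $n\ge2$. The subsets $D,N$ of $\mathrm{Sol}_{A_n}$ (which are subgroups) are defined as follows. If $n$ is odd: $D=\{\mathrm{diag}(x_0,x_0^{-1},x_0,\dots,x_0^{-1},x_0) : x_0\in\mathbb{C}^*\}$, and $N$ is the set of matrices $X$ such that, for some $x_1,\dots,x_{(n-1)/2}\in\mathbb{C}$: $X_{ii}=1$ for all $i$; $X_{ij}=x_{(j-i+1)/2}$ for $i$ odd, $j$ even, $i<j$; $X_{ij}=-x_{(i-j+1)/2}$ for $i$ odd, $j$ even, $i>j$; and $X_{ij}=0$ otherwise. If $n$ is even: $D=\{\mathrm{diag}(x_0,x_0^{-1},\dots,x_0,x_0^{-1}) : x_0\in\mathbb{C}^*\}$, and $N$ is the set of matrices $X$ such that, for some $x_1,\dots,x_{(n-2)/2}\in\mathbb{C}$: $X_{ii}=1$ for all $i$; $X_{ij}=x_{(j-i)/2}$ for $i,j$ odd, $i<j$; $X_{ij}=-x_{(i-j)/2}+x^*_{(i-j)/2}$ for $i,j$ even, $i>j$; and $X_{ij}=0$ otherwise. Here $x_1^*=0$ and $x_l^*=\sum_{a+b=l,\ a,b\ge1}x_a(x_b-x_b^*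 )$. The semidirect product is the internal one, with $D$ acting on $N$ by conjugation. *)

theory Defs
  imports "Jordan_Normal_Form.Matrix" "HOL-Algebra.Coset"
begin

(* Rows and columns of library matrices are numbered from 0.  mat1 takes an entry function
   in the 1-based indices of the text, on which all parity conditions depend. *)
definition mat1 :: "nat \<Rightarrow> (nat \<Rightarrow> nat \<Rightarrow> 'a) \<Rightarrow> 'a mat" where
  "mat1 n f = mat n n (\<lambda>(i, j). f (Suc i) (Suc j))"

definition A_mat :: "nat \<Rightarrow> complex mat" where
  "A_mat n = mat1 n (\<lambda>i j. if j = i + 1 then 1 else 0)"

definition Sol :: "nat \<Rightarrow> complex mat monoid" where
  "Sol n = \<lparr>carrier = {X \<in> carrier_mat n n. transpose_mat X * A_mat n * X = A_mat n},
            monoid.mult = (*), one = 1\<^sub>m n\<rparr>"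

(* The diagonal is x0, 1/x0, x0, ... for both parities of n; it ends in x0 if n is odd and
   in 1/x0 if n is even. *)
definition D_set :: "nat \<Rightarrow> complex mat set" where
  "D_set n = {mat1 n (\<lambda>i j. if i = j then (if odd i then x0 else inverse x0) else 0) |x0. x0 \<noteq> 0}"

(* The empty sum gives x*_1 = 0. *)
fun xstar :: "(nat \<Rightarrow> complex) \<Rightarrow> nat \<Rightarrow> complex" where
  "xstar x l = (\<Sum>a\<in>{1..<l}. x a * (x (l - a) - xstar x (l - a)))"

declare xstar.simps [simp del]

(* Parameters x_1, ..., x_m are given as a function on nat; only its values at 1, ..., m
   are used, with m = (n-1)/2 for n odd and m = (n-2)/2 for n even.  All divisions by 2
   below are exact. *)
definition N_odd_mat :: "nat \<Rightarrow> (nat \<Rightarrow> complex) \<Rightarrow> complex mat" where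
  "N_odd_mat n x = mat1 n (\<lambda>i j.
     if i = j then 1
     else if odd i \<and> even j \<and> i < j then x ((j - i + 1) div 2)
     else if odd i \<and> even j \<and> i > j then - x ((i - j + 1) div 2)
     else 0)"

definition N_even_mat :: "nat \<Rightarrow> (nat \<Rightarrow> complex) \<Rightarrow> complex mat" where
  "N_even_mat n x = mat1 n (\<lambda>i j.
     if i = j then 1
     else if odd i \<and> odd j \<and> i < j then x ((j - i) div 2)
     else if even i \<and> even j \<and> i > j then - x ((i - j) div 2) + xstar x ((i - j) div 2)
     else 0)"

definition N_set :: "nat \<Rightarrow> complex mat set" where
  "N_set n = (if odd n then range (N_odd_mat n) else range (N_even_mat n))"

definition semidirect_product ::
  "('a, 'm) monoid_scheme \<Rightarrow> ('b, 'k) monoid_scheme \<Rightarrow> ('b \<Rightarrow> 'a \<Rightarrow> 'a) \<Rightarrow> ('a \<times> 'b) monoid" where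
  "semidirect_product H K \<phi> =
     \<lparr>carrier = carrier H \<times> carrier K,
      monoid.mult = (\<lambda>(h, k) (h', k'). (h \<otimes>\<^bsub>H\<^esub> \<phi> k h', k \<otimes>\<^bsub>K\<^esub> k')),
      one = (\<one>\<^bsub>H\<^esub>, \<one>\<^bsub>K\<^esub>)\<rparr>"

definition conj_semidirect_product ::
  "('a, 'm) monoid_scheme \<Rightarrow> 'a set \<Rightarrow> 'a set \<Rightarrow> ('a \<times> 'a) monoid" where
  "conj_semidirect_product G H K =
     semidirect_product (G\<lparr>carrier := H\<rparr>) (G\<lparr>carrier := K\<rparr>) (\<lambda>k h. k \<otimes>\<^bsub>G\<^esub> h \<otimes>\<^bsub>G\<^esub> inv\<^bsub>G\<^esub> k)"

definition internal_semidirect :: "('a, 'm) monoid_scheme \<Rightarrow> 'a set \<Rightarrow> 'a set \<Rightarrow> bool" where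
  "internal_semidirect G H K \<longleftrightarrow>
     H \<lhd> G \<and> subgroup K G \<and> H \<inter> K = {\<one>\<^bsub>G\<^esub>} \<and> H <#>\<^bsub>G\<^esub> K = carrier G"

end

theory Submission
  imports Defs "Jordan_Normal_Form.Determinant"
begin

text \<open>Every solution \<open>X\<close> has first column \<open>X\<^sub>1\<^sub>1 e\<^sub>1\<close>, so \<open>X \<mapsto> X\<^sub>1\<^sub>1\<close> is a homomorphism
  onto the nonzero complex numbers; it is split by \<open>c \<mapsto> diag(c, 1/c, c, \<dots>)\<close>, whose image is \<open>D\<close>, and
  its kernel is \<open>N\<close>. The kernel is found from \<open>A X = Y A\<close> and \<open>A\<^sup>t X = Y A\<^sup>t\<close> with \<open>Y\<close> the inverse
  transpose of \<open>X\<close>: these make \<open>X\<close> invariant under shifts by two along the diagonals and force most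
  entries to vanish. What remains of \<open>X\<^sup>t A X = A\<close> is, for odd \<open>n\<close>, the antisymmetry of the
  off-diagonal entries. For even \<open>n\<close> it says that \<open>X\<close> splits into an upper and a lower
  unitriangular Toeplitz block whose generating functions are inverse to each other; this is the
  recursion for \<open>x\<^sup>*\<close>.\<close>

section \<open>Semidirect products and split extensions\<close>

text \<open>Multiplication \<open>(h, k) \<mapsto> h \<otimes> k\<close> is bijective by the two
  conditions on \<open>H\<close> and \<open>K\<close>, and multiplicative because
  \<open>(h k) (h' k') = h (k h' k^-1) (k k')\<close>.\<close>

lemma (in group) internal_semidirect_imp_iso:
  assumes "internal_semidirect G H K"
  shows "G \<cong> conj_semidirect_product G H K"
proof -
  let ?P = "conj_semidirect_product G H K" and ?f = "\<lambda>(h, k). h \<otimes> k"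
  interpret H: normal H G using assms by (simp add: internal_semidirect_def)
  interpret K: subgroup K G using assms by (simp add: internal_semidirect_def)
  have HK: "H \<inter> K = {\<one>}" and car: "H <#> K = carrier G"
    using assms by (auto simp: internal_semidirect_def)
  have bij: "bij_betw ?f (H \<times> K) (carrier G)"
    unfolding bij_betw_def
  proof
    show "inj_on ?f (H \<times> K)"
    proof (rule inj_onI, clarify)
      fix h k h' k' assume *: "h \<in> H" "k \<in> K" "h' \<in> H" "k' \<in> K" "h \<otimes> k = h' \<otimes> k'"
      \<comment> \<open>The left side lies in \<open>H\<close> and the right side in
        \<open>K\<close>, so both are in the trivial intersection.\<close>
      then have "inv h' \<otimes> h = k' \<otimes> inv k"
        by (metis H.mem_carrier K.mem_carrier inv_closed inv_solve_left inv_solve_right m_assoc m_closed)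
      moreover have "inv h' \<otimes> h \<in> H" "k' \<otimes> inv k \<in> K" using * by auto
      ultimately have "inv h' \<otimes> h = \<one>" "k' \<otimes> inv k = \<one>" using HK by auto
      then show "h = h' \<and> k = k'"
        using * by (metis H.mem_carrier K.mem_carrier inv_closed inv_equality inv_inv)
    qed
    have "h \<otimes> k \<in> ?f ` (H \<times> K)" if "h \<in> H" "k \<in> K" for h k
      using that by (intro image_eqI[of _ _ "(h, k)"]) auto
    then have "?f ` (H \<times> K) = H <#> K" by (auto simp: set_mult_def)
    then show "?f ` (H \<times> K) = carrier G" using car by simp
  qed
  have mult: "?f (x \<otimes>\<^bsub>?P\<^esub> y) = ?f x \<otimes> ?f y" if "x \<in> H \<times> K" "y \<in> H \<times> K" for x y
    using that by (auto simp: conj_semidirect_product_def semidirect_product_def m_assoc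
        simp flip: m_assoc[of "inv _"])
  have carP: "carrier ?P = H \<times> K"
    by (simp add: conj_semidirect_product_def semidirect_product_def)
  have clP: "x \<otimes>\<^bsub>?P\<^esub> y \<in> H \<times> K" if "x \<in> H \<times> K" "y \<in> H \<times> K" for x y
    using that by (auto simp: conj_semidirect_product_def semidirect_product_def H.inv_op_closed2)
  \<comment> \<open>The isomorphism has to start at \<open>G\<close>, so it is the inverse of
    multiplication.\<close>
  let ?g = "inv_into (H \<times> K) ?f"
  have bij': "bij_betw ?g (carrier G) (H \<times> K)" using bij by (rule bij_betw_inv_into)
  have "?g \<in> hom G ?P"
  proof (rule homI)
    fix x y assume xy: "x \<in> carrier G" "y \<in> carrier G"
    have g: "?g x \<in> H \<times> K" "?g y \<in> H \<times> K" using bij' xy by (auto dest: bij_betwE)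
    have f: "?f (?g x) = x" "?f (?g y) = y"
      using bij_betw_inv_into_right[OF bij] xy by auto
    have "?g x \<otimes>\<^bsub>?P\<^esub> ?g y = ?g (?f (?g x \<otimes>\<^bsub>?P\<^esub> ?g y))"
      using bij_betw_inv_into_left[OF bij clP[OF g]] by simp
    then show "?g (x \<otimes> y) = ?g x \<otimes>\<^bsub>?P\<^esub> ?g y"
      by (simp only: mult[OF g] f)
  qed (use bij' carP in \<open>auto dest: bij_betwE\<close>)
  then have "?g \<in> iso G ?P" using bij' carP by (simp add: iso_def)
  then show ?thesis by (auto simp: is_iso_def)
qed

text \<open>With \<open>d = s (\<pi> x)\<close> the factorization is \<open>x = (x d^-1) d\<close>;
  and since \<open>\<pi> (s q) = q\<close>, only the identity lies in both the kernel and the image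
  of \<open>s\<close>.\<close>

lemma split_extension_internal_semidirect:
  assumes "group_hom G Q \<pi>" and "group_hom Q G s"
    and \<pi>s: "\<And>q. q \<in> carrier Q \<Longrightarrow> \<pi> (s q) = q"
  shows "internal_semidirect G (kernel G Q \<pi>) (s ` carrier Q)"
proof -
  interpret \<pi>: group_hom G Q \<pi> by fact
  interpret s: group_hom Q G s by fact
  have "kernel G Q \<pi> \<inter> s ` carrier Q = {\<one>\<^bsub>G\<^esub>}"
  proof (rule equalityI)
    show "kernel G Q \<pi> \<inter> s ` carrier Q \<subseteq> {\<one>\<^bsub>G\<^esub>}"
      by (auto simp: kernel_def \<pi>s)
    show "{\<one>\<^bsub>G\<^esub>} \<subseteq> kernel G Q \<pi> \<inter> s ` carrier Q"
      using image_eqI[of "\<one>\<^bsub>G\<^esub>" s "\<one>\<^bsub>Q\<^esub>"] by (auto simp: kernel_def)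
  qed
  moreover have "kernel G Q \<pi> <#>\<^bsub>G\<^esub> s ` carrier Q = carrier G"
  proof (rule equalityI)
    show "kernel G Q \<pi> <#>\<^bsub>G\<^esub> s ` carrier Q \<subseteq> carrier G"
      by (auto simp: set_mult_def kernel_def)
    show "carrier G \<subseteq> kernel G Q \<pi> <#>\<^bsub>G\<^esub> s ` carrier Q"
    proof
      fix x assume x: "x \<in> carrier G"
      define d where "d = s (\<pi> x)"
      have d: "d \<in> carrier G" "\<pi> d = \<pi> x" using x by (auto simp: d_def \<pi>s)
      then have "x \<otimes>\<^bsub>G\<^esub> inv\<^bsub>G\<^esub> d \<in> kernel G Q \<pi>" using x by (simp add: kernel_def)
      moreover have "d \<in> s ` carrier Q" using x by (simp add: d_def)
      moreover have "x = (x \<otimes>\<^bsub>G\<^esub> inv\<^bsub>G\<^esub> d) \<otimes>\<^bsub>G\<^esub> d" using x d by (simp add: \<pi>.G.m_assoc)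
      ultimately show "x \<in> kernel G Q \<pi> <#>\<^bsub>G\<^esub> s ` carrier Q"
        unfolding set_mult_def by blast
    qed
  qed
  ultimately show ?thesis
    using \<pi>.normal_kernel s.img_is_subgroup by (simp add: internal_semidirect_def)
qed

section \<open>Multiplication by A as a shift, and the defining equation in entries\<close>

lemma A_mat_carrier [simp]: "A_mat n \<in> carrier_mat n n"
  by (simp add: A_mat_def mat1_def)

lemma A_mat_index: "i < n \<Longrightarrow> j < n \<Longrightarrow> A_mat n $$ (i, j) = (if j = Suc i then 1 else 0)"
  by (simp add: A_mat_def mat1_def)

lemma A_mat_mult_index:
  assumes "X \<in> carrier_mat n m" "i < n" "j < m"
  shows "(A_mat n * X) $$ (i, j) = (if Suc i < n then X $$ (Suc i, j) else 0)"
  using assms by (auto simp: A_mat_def mat1_def scalar_prod_def if_distrib[of "\<lambda>x. x * _"] cong: if_cong)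

lemma A_mat_transpose_mult_index:
  assumes "X \<in> carrier_mat n m" "i < n" "j < m"
  shows "(transpose_mat (A_mat n) * X) $$ (i, j) = (if 0 < i then X $$ (i - 1, j) else 0)"
proof (cases i)
  case (Suc k)
  with assms show ?thesis
    by (auto simp: A_mat_def mat1_def scalar_prod_def if_distrib[of "\<lambda>x. x * _"] cong: if_cong)
qed (use assms in \<open>auto simp: A_mat_def mat1_def scalar_prod_def\<close>)

lemma mult_A_mat_index:
  assumes "X \<in> carrier_mat m n" "i < m" "j < n"
  shows "(X * A_mat n) $$ (i, j) = (if 0 < j then X $$ (i, j - 1) else 0)"
proof (cases j)
  case (Suc k)
  with assms show ?thesis
    by (auto simp: A_mat_def mat1_def scalar_prod_def if_distrib[of "\<lambda>x. _ * x"] cong: if_cong)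
qed (use assms in \<open>auto simp: A_mat_def mat1_def scalar_prod_def\<close>)

lemma mult_A_mat_transpose_index:
  assumes "X \<in> carrier_mat m n" "i < m" "j < n"
  shows "(X * transpose_mat (A_mat n)) $$ (i, j) = (if Suc j < n then X $$ (i, Suc j) else 0)"
  using assms by (auto simp: A_mat_def mat1_def scalar_prod_def if_distrib[of "\<lambda>x. _ * x"] cong: if_cong)

text \<open>The sum is the bilinear form of \<open>A_mat n\<close> at columns \<open>i\<close> and
  \<open>j\<close>; solutions are the matrices that preserve this form.\<close>

lemma mem_Sol_iff:
  "X \<in> carrier (Sol n) \<longleftrightarrow> X \<in> carrier_mat n n \<and>
     (\<forall>i<n. \<forall>j<n. (\<Sum>k<n-1. X $$ (k, i) * X $$ (Suc k, j)) = (if j = Suc i then 1 else 0))"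
proof (cases "X \<in> carrier_mat n n")
  case True
  have *: "(transpose_mat X * A_mat n * X) $$ (i, j) = (\<Sum>k<n-1. X $$ (k, i) * X $$ (Suc k, j))"
    if "i < n" "j < n" for i j
  proof -
    obtain m where m: "n = Suc m" using less_imp_Suc_add[OF \<open>i < n\<close>] by auto
    have "(transpose_mat X * A_mat n * X) $$ (i, j) = (transpose_mat X * (A_mat n * X)) $$ (i, j)"
      using True by (subst assoc_mult_mat[of _ n n _ n _ n] mult_carrier_mat[of _ n n _ n]) auto
    also have "\<dots> = (\<Sum>k<n. X $$ (k, i) * (A_mat n * X) $$ (k, j))"
      using True that by (auto simp: scalar_prod_def atLeast0LessThan A_mat_def mat1_def intro!: sum.cong)
    also have "\<dots> = (\<Sum>k<n. X $$ (k, i) * (if Suc k < n then X $$ (Suc k, j) else 0))"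
      using True that by (intro sum.cong refl) (subst A_mat_mult_index, auto)
    also have "\<dots> = (\<Sum>k<n-1. X $$ (k, i) * X $$ (Suc k, j))"
      by (simp add: m)
    finally show ?thesis .
  qed
  have "transpose_mat X * A_mat n * X = A_mat n \<longleftrightarrow>
      (\<forall>i<n. \<forall>j<n. (transpose_mat X * A_mat n * X) $$ (i, j) = A_mat n $$ (i, j))"
    (is "?C = _ \<longleftrightarrow> _")
  proof -
    have "?C \<in> carrier_mat n n" using True by (simp add: mult_carrier_mat[of _ n n _ n])
    with A_mat_carrier[of n] show ?thesis
      by (metis carrier_matD eq_matI)
  qed
  also have "\<dots> \<longleftrightarrow> (\<forall>i<n. \<forall>j<n. (\<Sum>k<n-1. X $$ (k, i) * X $$ (Suc k, j)) = (if j = Suc i then 1 else 0))"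
    by (simp add: * A_mat_index del: index_mult_mat)
  finally show ?thesis
    using True by (simp add: Sol_def)
qed (simp add: Sol_def)

section \<open>The solutions form a group\<close>

text \<open>Transposing the equation supplies the opposite shift \<open>A^t\<close> with the same
  \<open>X\<close>.\<close>

lemma transpose_congruence:
  fixes X B :: "'a::comm_semiring_0 mat"
  assumes X: "X \<in> carrier_mat n n" and B: "B \<in> carrier_mat n n"
    and eq: "transpose_mat X * B * X = B"
  shows "transpose_mat X * transpose_mat B * X = transpose_mat B"
proof -
  have "transpose_mat B = transpose_mat (transpose_mat X * B * X)" using eq by simp
  also have "\<dots> = transpose_mat X * (transpose_mat B * X)"
    using X B by (simp add: transpose_mult[of _ n n _ n])
  finally show ?thesis
    using X B by (simp add: assoc_mult_mat[of _ n n _ n _ n] mult_carrier_mat[of _ n n _ n])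
qed

text \<open>\<open>A\<close> is singular, so taking determinants in the equation gives nothing.
  Instead, a vector killed by \<open>X\<close> is killed by \<open>A\<close> and by
  \<open>A^t\<close>, whose kernels meet only in 0 for \<open>n \<ge> 2\<close>.\<close>

lemma Sol_ex_inverse:
  assumes n: "n \<ge> 2" and X: "X \<in> carrier (Sol n)"
  obtains V where "V \<in> carrier_mat n n" "X * V = 1\<^sub>m n" "V * X = 1\<^sub>m n"
proof -
  have Xc: "X \<in> carrier_mat n n" and eq: "transpose_mat X * A_mat n * X = A_mat n"
    using X by (auto simp: Sol_def)
  have eqT: "transpose_mat X * transpose_mat (A_mat n) * X = transpose_mat (A_mat n)"
    using Xc eq by (intro transpose_congruence) auto
  have "det X \<noteq> 0"
  proof
    assume "det X = 0"
    then obtain v where v: "v \<in> carrier_vec n" "v \<noteq> 0\<^sub>v n" "X *\<^sub>v v = 0\<^sub>v n"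
      using det_0_iff_vec_prod_zero_field[OF Xc] by auto
    have z: "B *\<^sub>v v = 0\<^sub>v n"
      if B: "B \<in> carrier_mat n n" and "transpose_mat X * B * X = B" for B :: "complex mat"
    proof -
      have "B *\<^sub>v v = (transpose_mat X * B * X) *\<^sub>v v" using that by simp
      also have "\<dots> = (transpose_mat X * B) *\<^sub>v (X *\<^sub>v v)"
        using Xc B v by (intro assoc_mult_mat_vec[of _ n n _ n]) auto
      also have "\<dots> = 0\<^sub>v n" using Xc B v(3) by (auto intro!: eq_vecI simp del: assoc_mult_mat_vec)
      finally show ?thesis .
    qed
    have "v = 0\<^sub>v n"
    proof (rule eq_vecI)
      fix j assume j: "j < dim_vec (0\<^sub>v n)"
      show "v $ j = 0\<^sub>v n $ j"
      proof (cases j)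
        case 0
        \<comment> \<open>\<open>A\<close> sees every coordinate except the first; row 1 of
          \<open>A^t\<close>, present since \<open>n \<ge> 2\<close>, supplies that one.\<close>
        have "(transpose_mat (A_mat n) *\<^sub>v v) $ 1 = v $ 0"
          using v n by (auto simp: A_mat_def mat1_def scalar_prod_def if_distrib[of "\<lambda>x. x * _"] cong: if_cong)
        then show ?thesis using z[OF _ eqT] n 0 by simp
      next
        case (Suc k)
        have "(A_mat n *\<^sub>v v) $ k = v $ Suc k"
          using v n j Suc by (auto simp: A_mat_def mat1_def scalar_prod_def if_distrib[of "\<lambda>x. x * _"] cong: if_cong)
        then show ?thesis using z[OF _ eq] j Suc by simp
      qed
    qed (use v in auto)
    then show False using v by simp
  qed
  from det_non_zero_imp_unit[OF Xc this, of "()"] show ?thesis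
    using that by (auto simp: Units_def ring_mat_def)
qed

lemma Sol_group:
  assumes "n \<ge> 2"
  shows "group (Sol n)"
proof (rule groupI)
  fix X Y assume "X \<in> carrier (Sol n)" "Y \<in> carrier (Sol n)"
  then have X: "X \<in> carrier_mat n n" "transpose_mat X * A_mat n * X = A_mat n"
    and Y: "Y \<in> carrier_mat n n" "transpose_mat Y * A_mat n * Y = A_mat n"
    by (auto simp: Sol_def)
  have "transpose_mat (X * Y) * A_mat n * (X * Y)
      = transpose_mat Y * (transpose_mat X * A_mat n * X) * Y"
    using X(1) Y(1) by (simp add: transpose_mult[of _ n n _ n] assoc_mult_mat[of _ n n _ n _ n]
        mult_carrier_mat[of _ n n _ n])
  with X Y show "X \<otimes>\<^bsub>Sol n\<^esub> Y \<in> carrier (Sol n)" by (simp add: Sol_def)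
next
  fix X assume XS: "X \<in> carrier (Sol n)"
  then have X: "X \<in> carrier_mat n n" "transpose_mat X * A_mat n * X = A_mat n"
    by (auto simp: Sol_def)
  obtain V where V: "V \<in> carrier_mat n n" "X * V = 1\<^sub>m n" "V * X = 1\<^sub>m n"
    by (rule Sol_ex_inverse[OF assms XS])
  have VX: "transpose_mat V * transpose_mat X = 1\<^sub>m n"
    using V X by (simp flip: transpose_mult[of X n n V n])
  have "transpose_mat V * A_mat n * V = transpose_mat V * (transpose_mat X * A_mat n * X) * V"
    by (simp add: X)
  also have "\<dots> = (transpose_mat V * transpose_mat X) * A_mat n * (X * V)"
    using X(1) V(1) by (simp add: assoc_mult_mat[of _ n n _ n _ n] mult_carrier_mat[of _ n n _ n])
  also have "\<dots> = A_mat n" using V VX by (simp add: left_mult_one_mat[of _ n n] right_mult_one_mat[of _ n n])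
  finally show "\<exists>V\<in>carrier (Sol n). V \<otimes>\<^bsub>Sol n\<^esub> X = \<one>\<^bsub>Sol n\<^esub>"
    using V by (auto simp: Sol_def)
qed (auto simp: Sol_def assoc_mult_mat[of _ n n _ n _ n] mult_carrier_mat[of _ n n _ n]
    left_mult_one_mat[of _ n n] right_mult_one_mat[of _ n n])

section \<open>Shape of a solution\<close>

text \<open>The two shift equations express an inner entry of the inverse transpose \<open>Y\<close>
  by an entry of \<open>X\<close> in two ways, and eliminating \<open>Y\<close> gives the shift by
  two. At the border one side is zero, which gives the four zero lines.\<close>

lemma Sol_entries:
  assumes n: "n \<ge> 2" and XS: "X \<in> carrier (Sol n)"
  shows Sol_shift2: "\<And>i j. i + 2 < n \<Longrightarrow> j + 2 < n \<Longrightarrow> X $$ (i + 2, j + 2) = X $$ (i, j)"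
    and Sol_first_col: "\<And>i. 0 < i \<Longrightarrow> i < n \<Longrightarrow> X $$ (i, 0) = 0"
    and Sol_last_col: "\<And>i. i < n - 1 \<Longrightarrow> X $$ (i, n - 1) = 0"
    and Sol_second_row: "\<And>j. 2 \<le> j \<Longrightarrow> j < n \<Longrightarrow> X $$ (1, j) = 0"
    and Sol_penultimate_row: "\<And>j. j < n - 2 \<Longrightarrow> X $$ (n - 2, j) = 0"
proof -
  have X: "X \<in> carrier_mat n n" "transpose_mat X * A_mat n * X = A_mat n"
    using XS by (auto simp: Sol_def)
  obtain V where V: "V \<in> carrier_mat n n" "X * V = 1\<^sub>m n" "V * X = 1\<^sub>m n"
    by (rule Sol_ex_inverse[OF assms])
  define Y where "Y = transpose_mat V"
  have Y: "Y \<in> carrier_mat n n" "Y * transpose_mat X = 1\<^sub>m n"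
    using V X by (auto simp: Y_def simp flip: transpose_mult[of X n n V n])
  have XT: "transpose_mat X * transpose_mat (A_mat n) * X = transpose_mat (A_mat n)"
    using X by (intro transpose_congruence) auto
  have shift: "B * X = Y * B" if "B \<in> carrier_mat n n" "transpose_mat X * B * X = B" for B
  proof -
    have "Y * B = Y * (transpose_mat X * B * X)" using that by simp
    also have "\<dots> = (Y * transpose_mat X) * (B * X)"
      using X(1) Y(1) that(1) by (simp add: assoc_mult_mat[of _ n n _ n _ n] mult_carrier_mat[of _ n n _ n])
    also have "\<dots> = B * X"
      using Y X(1) that(1) by (simp add: left_mult_one_mat[of _ n n])
    finally show ?thesis by simp
  qed
  have up: "(if Suc i < n then X $$ (Suc i, j) else 0) = (if 0 < j then Y $$ (i, j - 1) else 0)"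
    if "i < n" "j < n" for i j
    using shift[of "A_mat n"] that X Y(1) by (simp flip: A_mat_mult_index mult_A_mat_index[of _ n n])
  have down: "(if 0 < i then X $$ (i - 1, j) else 0) = (if Suc j < n then Y $$ (i, Suc j) else 0)"
    if "i < n" "j < n" for i j
    using shift[of "transpose_mat (A_mat n)"] that X XT Y(1)
    by (simp flip: A_mat_transpose_mult_index mult_A_mat_transpose_index[of _ n n])
  \<comment> \<open>Both entries equal \<open>Y $$ (i + 1, j + 1)\<close>.\<close>
  show "X $$ (i + 2, j + 2) = X $$ (i, j)" if "i + 2 < n" "j + 2 < n" for i j
    using up[of "Suc i" "j + 2"] down[of "Suc i" j] that by simp
  show "X $$ (i, 0) = 0" if "0 < i" "i < n" for i
    using up[of "i - 1" 0] that by simp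
  show "X $$ (i, n - 1) = 0" if "i < n - 1" for i
    using down[of "Suc i" "n - 1"] that by simp
  show "X $$ (1, j) = 0" if j: "2 \<le> j" "j < n" for j
  proof -
    obtain k where "j = k + 2" using le_Suc_ex[OF j(1)] by auto
    \<comment> \<open>\<open>up\<close> equates the entry with \<open>Y $$ (0, j - 1)\<close>, and
      \<open>down\<close> in row 0 makes that zero.\<close>
    then show ?thesis using up[of 0 j] down[of 0 k] j by simp
  qed
  show "X $$ (n - 2, j) = 0" if j: "j < n - 2" for j
  proof -
    obtain m where "n = m + 2" using le_Suc_ex[OF n] by auto
    then show ?thesis using down[of "n - 1" j] up[of "n - 1" "j + 2"] j by (simp split: if_splits)
  qed
qed

context
  fixes n :: nat and X :: "complex mat"
  assumes n: "n \<ge> 2" and X: "X \<in> carrier (Sol n)"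
begin

lemma Sol_shift:
  assumes "i + 2 * k < n" "j + 2 * k < n"
  shows "X $$ (i + 2 * k, j + 2 * k) = X $$ (i, j)"
  using assms
proof (induction k)
  case (Suc k)
  then show ?case using Sol_shift2[OF n X, of "i + 2 * k" "j + 2 * k"] by simp
qed simp

text \<open>Here and in the next three lemmas an even shift along the diagonal moves the entry onto
  a zero line. The first two count parity from the top left corner, the last two from the bottom
  right one, where the parity of \<open>n\<close> enters.\<close>

lemma Sol_even_col_below:
  assumes "even j" "j < i" "i < n"
  shows "X $$ (i, j) = 0"
  using assms Sol_shift[of "i - j" "j div 2" 0] Sol_first_col[OF n X, of "i - j"] by simp

lemma Sol_odd_row_right:
  assumes "odd i" "i < j" "j < n"
  shows "X $$ (i, j) = 0"
proof -
  obtain k where k: "i = 2 * k + 1" using assms(1) by (blast elim: oddE)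
  then show ?thesis
    using assms Sol_shift[of 1 k "j - 2 * k"] Sol_second_row[OF n X, of "j - 2 * k"] by simp
qed

lemma Sol_col_above:
  assumes "even (n - Suc j)" "i < j" "j < n"
  shows "X $$ (i, j) = 0"
proof -
  obtain k where k: "n - Suc j = 2 * k" using assms(1) by (blast elim: evenE)
  have j: "j + 2 * k = n - 1" using k assms by simp
  show ?thesis
    using assms Sol_shift[of i k j] Sol_last_col[OF n X, of "i + 2 * k"] j by simp
qed

lemma Sol_row_left:
  assumes "even (n - i)" "j < i" "i < n"
  shows "X $$ (i, j) = 0"
proof -
  have "even (n - 2 - i)" using assms by simp
  then obtain k where k: "n - 2 - i = 2 * k" by (blast elim: evenE)
  \<comment> \<open>Truncated subtraction makes \<open>n - 2 - i\<close> zero at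
    \<open>i = n - 1\<close> too; parity excludes that row.\<close>
  have "i \<noteq> n - 1" using assms by auto
  then have i: "i + 2 * k = n - 2" using k assms by simp
  have "i + 2 * k < n" "j + 2 * k < n" "j + 2 * k < n - 2" using i assms n by auto
  then show ?thesis
    using Sol_shift[of i k j] Sol_penultimate_row[OF n X, of "j + 2 * k"] i by simp
qed

lemma Sol_diag:
  assumes "i < n"
  shows "X $$ (i, i) = (if even i then X $$ (0, 0) else X $$ (1, 1))"
proof (cases "even i")
  case True
  then show ?thesis using Sol_shift[of 0 "i div 2" 0] assms by simp
next
  case False
  then obtain k where k: "i = 2 * k + 1" by (blast elim: oddE)
  then show ?thesis using Sol_shift[of 1 k 1] assms by simp
qed

text \<open>In entry (0, 1) of the defining equation the zeros of the first column leave one term.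
  With \<open>Sol_diag\<close>, the corner entry then determines the whole diagonal.\<close>

lemma Sol_diag_mult: "X $$ (0, 0) * X $$ (1, 1) = 1"
proof -
  obtain m where m: "n = Suc (Suc m)" using n by (metis add_2_eq_Suc le_Suc_ex)
  have "(\<Sum>k<n-1. X $$ (k, 0) * X $$ (Suc k, 1)) = 1"
    using X n by (simp add: mem_Sol_iff)
  also have "(\<Sum>k<n-1. X $$ (k, 0) * X $$ (Suc k, 1)) = X $$ (0, 0) * X $$ (1, 1)"
    using Sol_first_col[OF n X] by (simp add: m sum.lessThan_Suc_shift del: sum.lessThan_Suc)
  finally show ?thesis .
qed

end

section \<open>The unipotent solutions for odd n\<close>

text \<open>Library indices start at 0, so the parities of the definition are interchanged.\<close>

lemma N_odd_mat_index:
  assumes "i < n" "j < n"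
  shows "N_odd_mat n x $$ (i, j) =
    (if i = j then 1
     else if even i \<and> odd j \<and> i < j then x ((j - i + 1) div 2)
     else if even i \<and> odd j \<and> i > j then - x ((i - j + 1) div 2)
     else 0)"
  using assms by (simp add: N_odd_mat_def mat1_def)

text \<open>Of two consecutive rows one has odd index, hence is a row of the identity matrix. Each
  product in the sum contributes at most one entry of \<open>X\<close>, and the quadratic equation
  becomes linear.\<close>

lemma mem_Sol_odd_unipotent_iff:
  assumes n: "odd n" and X: "X \<in> carrier_mat n n"
    and diag: "\<And>i. i < n \<Longrightarrow> X $$ (i, i) = 1"
    and off: "\<And>i j. i < n \<Longrightarrow> j < n \<Longrightarrow> i \<noteq> j \<Longrightarrow> odd i \<or> even j \<Longrightarrow> X $$ (i, j) = 0"
  shows "X \<in> carrier (Sol n) \<longleftrightarrow>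
    (\<forall>i<n. \<forall>j<n. odd i \<longrightarrow> odd j \<longrightarrow> X $$ (j - 1, i) + X $$ (i + 1, j) = 0)"
proof -
  have sum: "(\<Sum>k<n-1. X $$ (k, i) * X $$ (Suc k, j))
      = (if odd j then X $$ (j - 1, i) else 0) + (if odd i then X $$ (i + 1, j) else 0)"
    (is "?S = ?R") if ij: "i < n" "j < n" for i j
  proof -
    have "?S = (\<Sum>k<n-1. (if k = j - 1 then if odd j then X $$ (j - 1, i) else 0 else 0)
        + (if k = i then if odd i then X $$ (i + 1, j) else 0 else 0))"
    proof (rule sum.cong)
      fix k assume k: "k \<in> {..<n-1}"
      show "X $$ (k, i) * X $$ (Suc k, j) = (if k = j - 1 then if odd j then X $$ (j - 1, i) else 0 else 0)
        + (if k = i then if odd i then X $$ (i + 1, j) else 0 else 0)"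
      proof (cases "even k")
        case True
        then have "X $$ (Suc k, j) = (if j = Suc k then 1 else 0)" using k ij diag off by auto
        then show ?thesis using True by (cases j) auto
      next
        case False
        then have "X $$ (k, i) = (if i = k then 1 else 0)" using k ij diag off by auto
        then show ?thesis using False by (cases j) auto
      qed
    qed simp
    also have "\<dots> = ?R"
    proof -
      have "odd j \<Longrightarrow> j - 1 < n - 1" using ij by (cases j) auto
      \<comment> \<open>The last index \<open>n - 1\<close> is even, so an odd row is never the
        last.\<close>
      moreover have "odd i \<Longrightarrow> i < n - 1" using ij n
        by (metis One_nat_def Suc_lessI Suc_pred even_Suc less_Suc_eq_0_disj lessI not_less_eq odd_pos)
      ultimately show ?thesis by (auto simp: sum.distrib)
    qed
    finally show ?thesis .
  qed
  \<comment> \<open>For mixed parities the surviving entry lies in an even column and is 0 or 1 as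
    required; for two even indices both sides are 0.\<close>
  have "(\<Sum>k<n-1. X $$ (k, i) * X $$ (Suc k, j)) = (if j = Suc i then 1 else 0) \<longleftrightarrow>
      (odd i \<longrightarrow> odd j \<longrightarrow> X $$ (j - 1, i) + X $$ (i + 1, j) = 0)"
    if ij: "i < n" "j < n" for i j
  proof (cases "odd i"; cases "odd j")
    assume p: "odd i" "\<not> odd j"
    then have "Suc i < n" using ij n by (metis Suc_lessI even_Suc)
    then show ?thesis using p ij diag off[of "Suc i" j] unfolding sum[OF ij] by auto
  next
    assume p: "\<not> odd i" "odd j"
    then obtain l where l: "j = Suc l" by (cases j) auto
    then show ?thesis using p l ij diag off[of l i] unfolding sum[OF ij] by auto
  qed (unfold sum[OF ij], auto)
  then show ?thesis using X by (simp add: mem_Sol_iff)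
qed

lemma N_odd_mat_in_Sol:
  assumes "odd n"
  shows "N_odd_mat n x \<in> carrier (Sol n)"
proof (subst mem_Sol_odd_unipotent_iff[OF assms], safe)
  fix i j assume ij: "i < n" "j < n" "odd i" "odd j"
  have i: "i + 1 < n" using ij assms by (metis Suc_eq_plus1 Suc_lessI even_Suc)
  obtain l where l: "j = Suc l" using ij by (cases j) auto
  \<comment> \<open>Both entries lie at distance \<open>|i + 1 - j|\<close> from the diagonal, on
    opposite sides, so they carry the same parameter with opposite signs.\<close>
  show "N_odd_mat n x $$ (j - 1, i) + N_odd_mat n x $$ (i + 1, j) = 0"
    using ij i l by (auto simp: N_odd_mat_index Suc_diff_le)
qed (auto simp: N_odd_mat_index, simp add: N_odd_mat_def mat1_def)

text \<open>The parameters are read off the first row, where library column \<open>2 * l - 1\<close>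
  is column \<open>2 * l\<close> of the text. Shifts give the entries above the diagonal,
  antisymmetry those below.\<close>

lemma Sol_odd_eq_N_odd_mat:
  assumes n: "n \<ge> 2" "odd n" and X: "X \<in> carrier (Sol n)" and X0: "X $$ (0, 0) = 1"
  shows "X = N_odd_mat n (\<lambda>l. X $$ (0, 2 * l - 1))"
proof (rule eq_matI)
  have Xc: "X \<in> carrier_mat n n" using X by (simp add: Sol_def)
  have diag: "X $$ (i, i) = 1" if "i < n" for i
    using Sol_diag[OF n(1) X that] Sol_diag_mult[OF n(1) X] X0 by simp
  \<comment> \<open>For odd \<open>n\<close> the zero lemmas clear odd rows and even columns on both
    sides of the diagonal.\<close>
  have off: "X $$ (i, j) = 0" if "i < n" "j < n" "i \<noteq> j" "odd i \<or> even j" for i j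
  proof (cases "odd i")
    case True
    then have "even (n - i)" using n that by simp
    then show ?thesis
      using that True Sol_odd_row_right[OF n(1) X] Sol_row_left[OF n(1) X] by (meson linorder_neqE_nat)
  next
    case False
    then have "even (n - Suc j)" using n that by simp
    then show ?thesis
      using that False Sol_even_col_below[OF n(1) X] Sol_col_above[OF n(1) X] by (meson linorder_neqE_nat)
  qed
  have anti: "X $$ (j - 1, i) + X $$ (i + 1, j) = 0" if "i < n" "j < n" "odd i" "odd j" for i j
    using mem_Sol_odd_unipotent_iff[OF n(2) Xc diag off] X that by blast
  have right: "X $$ (i, j) = X $$ (0, 2 * ((j - i + 1) div 2) - 1)"
    if "i < j" "j < n" "even i" "odd j" for i j
  proof -
    have "odd (j - i)" using that by simp
    then have "2 * ((j - i + 1) div 2) - 1 = j - i" by (elim oddE) simp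
    then show ?thesis using that Sol_shift[OF n(1) X, of 0 "i div 2" "j - i"] by simp
  qed
  fix i j
  assume "i < dim_row (N_odd_mat n (\<lambda>l. X $$ (0, 2 * l - 1)))"
    "j < dim_col (N_odd_mat n (\<lambda>l. X $$ (0, 2 * l - 1)))"
  then have ij: "i < n" "j < n" by (auto simp: N_odd_mat_def mat1_def)
  consider "i = j" | "i \<noteq> j" "odd i \<or> even j" | "i < j" "even i" "odd j" | "j < i" "even i" "odd j"
    by linarith
  then show "X $$ (i, j) = N_odd_mat n (\<lambda>l. X $$ (0, 2 * l - 1)) $$ (i, j)"
  proof cases
    case 4
    obtain a b where ab: "i = Suc a" "j = Suc b" using 4 by (cases i; cases j) auto
    \<comment> \<open>The partner position \<open>(j - 1, i - 1)\<close> is above the diagonal, so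
      \<open>right\<close> applies to it.\<close>
    have "X $$ (i, j) = - X $$ (b, a)"
      using anti[of a j] 4 ij ab by (simp add: eq_neg_iff_add_eq_0 add.commute)
    also have "X $$ (b, a) = X $$ (0, 2 * ((a - b + 1) div 2) - 1)"
      using right[of b a] 4 ij ab by simp
    finally show ?thesis using 4 ij ab by (simp add: N_odd_mat_index)
  next
    case 3
    show ?thesis unfolding right[OF 3(1) ij(2) 3(2,3)] using 3 ij by (simp add: N_odd_mat_index)
  qed (use ij diag off in \<open>auto simp: N_odd_mat_index\<close>)
qed (use X in \<open>auto simp: Sol_def N_odd_mat_def mat1_def\<close>)

section \<open>Convolutions and reciprocal power series\<close>

lemma sum_lessThan_odd_split:
  fixes g :: "nat \<Rightarrow> 'a::comm_monoid_add"
  shows "(\<Sum>k<Suc (2 * m). g k) = (\<Sum>k\<le>m. g (2 * k)) + (\<Sum>k<m. g (Suc (2 * k)))"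
  by (induction m) (simp_all add: ac_simps)

text \<open>The factors are column \<open>p\<close> of an upper and column \<open>q\<close> of a
  lower triangular Toeplitz matrix. Their inner product is the coefficient of degree
  \<open>p - q\<close> in the product of the generating functions.\<close>

lemma sum_window_convolution:
  fixes f g :: "nat \<Rightarrow> 'a::comm_semiring_0"
  assumes "q \<le> p" "p \<le> m"
  shows "(\<Sum>k\<le>m. (if k \<le> p then f (p - k) else 0) * (if q \<le> k then g (k - q) else 0))
    = (\<Sum>k\<le>p - q. f (p - q - k) * g k)"
proof -
  have "(\<Sum>k\<le>m. (if k \<le> p then f (p - k) else 0) * (if q \<le> k then g (k - q) else 0))
      = (\<Sum>k\<in>{q..p}. f (p - k) * g (k - q))"
    using assms by (intro sum.mono_neutral_cong_right) auto
  also have "\<dots> = (\<Sum>k\<le>p - q. f (p - q - k) * g k)"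
    using assms by (intro sum.reindex_bij_witness[of _ "\<lambda>k. k + q" "\<lambda>k. k - q"]) auto
  finally show ?thesis .
qed

text \<open>A power series with constant term 1 can be cancelled, also in truncated form: the
  summand \<open>k = l\<close> isolates \<open>g l\<close>, the others agree by induction.\<close>

lemma convolution_left_cancel:
  fixes f g h :: "nat \<Rightarrow> 'a::comm_ring_1"
  assumes f0: "f 0 = 1"
    and eq: "\<And>l. l \<le> m \<Longrightarrow> (\<Sum>k\<le>l. f (l - k) * g k) = (\<Sum>k\<le>l. f (l - k) * h k)"
  shows "l \<le> m \<Longrightarrow> g l = h l"
proof (induction l rule: less_induct)
  case (less l)
  have "(\<Sum>k<l. f (l - k) * g k) = (\<Sum>k<l. f (l - k) * h k)"
    using less by (intro sum.cong) auto
  then show ?case using eq[OF less.prems] f0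
    by (simp flip: lessThan_Suc_atMost)
qed

text \<open>Without its end terms \<open>k = 0\<close> and \<open>k = l\<close>, the sum is the
  recursion for \<open>xstar x l\<close> up to sign. So the second factor lists the coefficients of
  the reciprocal of the power series of \<open>x\<close>.\<close>

lemma xstar_convolution_inverse:
  assumes x0: "x 0 = 1"
  shows "(\<Sum>k\<le>l. x (l - k) * (if k = 0 then 1 else xstar x k - x k)) = (if l = 0 then 1 else 0)"
proof (cases l)
  case (Suc m)
  have "(\<Sum>k\<le>l. x (l - k) * (if k = 0 then 1 else xstar x k - x k))
      = x l + (\<Sum>k\<in>{1..<l}. x (l - k) * (xstar x k - x k)) + (xstar x l - x l)"
  proof -
    have *: "{..l} = insert 0 (insert l {1..<l})" using Suc by auto
    have "(\<Sum>k\<in>{1..<l}. x (l - k) * (if k = 0 then 1 else xstar x k - x k))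
        = (\<Sum>k\<in>{1..<l}. x (l - k) * (xstar x k - x k))"
      by (intro sum.cong) auto
    then show ?thesis unfolding * using x0 Suc by (simp add: add.assoc add.commute)
  qed
  also have "(\<Sum>k\<in>{1..<l}. x (l - k) * (xstar x k - x k)) = - xstar x l"
  proof -
    have "(\<Sum>k\<in>{1..<l}. x (l - k) * (xstar x k - x k)) = (\<Sum>a\<in>{1..<l}. x a * (xstar x (l - a) - x (l - a)))"
      by (rule sum.reindex_bij_witness[of _ "\<lambda>k. l - k" "\<lambda>k. l - k"]) auto
    also have "\<dots> = - (\<Sum>a\<in>{1..<l}. x a * (x (l - a) - xstar x (l - a)))"
      by (simp add: algebra_simps flip: sum_negf)
    also have "\<dots> = - xstar x l" by (subst (2) xstar.simps) simp
    finally show ?thesis .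
  qed
  finally show ?thesis by (simp add: Suc)
qed (simp add: x0)

section \<open>The unipotent solutions for even n\<close>

lemma N_even_mat_index:
  assumes "i < n" "j < n"
  shows "N_even_mat n x $$ (i, j) =
    (if i = j then 1
     else if even i \<and> even j \<and> i < j then x ((j - i) div 2)
     else if odd i \<and> odd j \<and> i > j then xstar x ((i - j) div 2) - x ((i - j) div 2)
     else 0)"
  using assms by (simp add: N_even_mat_def mat1_def)

text \<open>The recursion reads \<open>x\<close> only at positive indices. This allows setting
  \<open>x 0\<close> to 1, the constant term of the power series.\<close>

lemma xstar_cong:
  assumes "\<And>k. 0 < k \<Longrightarrow> x k = y k"
  shows "xstar x l = xstar y l"
proof (induction l rule: less_induct)
  case (less l)
  have "(\<Sum>a\<in>{1..<l}. x a * (x (l - a) - xstar x (l - a)))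
      = (\<Sum>a\<in>{1..<l}. y a * (y (l - a) - xstar y (l - a)))"
    using less assms by (intro sum.cong) auto
  then show ?case by (subst (1 2) xstar.simps)
qed

lemma N_even_mat_cong:
  assumes "\<And>k. 0 < k \<Longrightarrow> x k = y k"
  shows "N_even_mat n x = N_even_mat n y"
  using assms xstar_cong[OF assms]
  by (intro eq_matI) (auto simp: N_even_mat_def mat1_def elim!: evenE oddE)

text \<open>Even and odd indices form two Toeplitz blocks with reciprocal series. At
  \<open>(i, j)\<close> of mixed parity the equation pairs a column of one block with a column of
  the other, which is a convolution; at equal parity every summand has a zero factor.\<close>

lemma N_even_mat_in_Sol:
  assumes n: "n \<ge> 2" "even n"
  shows "N_even_mat n x \<in> carrier (Sol n)"
proof -
  \<comment> \<open>With value 1 at index 0 the diagonal fits the Toeplitz formula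
    \<open>y (p - k)\<close>.\<close>
  define y where "y = x(0 := 1)"
  define z where "z k = (if k = 0 then 1 else xstar y k - y k)" for k
  define N where "N = N_even_mat n y"
  have y0: "y 0 = 1" by (simp add: y_def)
  have NN: "N_even_mat n x = N" unfolding N_def by (rule N_even_mat_cong) (simp add: y_def)
  have "even (n - 2)" using n by simp
  then obtain m where "n - 2 = 2 * m" by (blast elim: evenE)
  then have m: "n = Suc (Suc (2 * m))" using n by simp
  have ee: "N $$ (2 * k, 2 * p) = (if k \<le> p then y (p - k) else 0)" if "k \<le> m" "p \<le> m" for k p
    using that m y0 by (auto simp: N_def N_even_mat_index simp flip: diff_mult_distrib2)
  have oo: "N $$ (Suc (2 * k), Suc (2 * q)) = (if q \<le> k then z (k - q) else 0)"
    if "k \<le> m" "q \<le> m" for k q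
    using that m by (auto simp: N_def N_even_mat_index z_def simp flip: diff_mult_distrib2)
  have eo: "N $$ (i, j) = 0" if "i < n" "j < n" "even i \<noteq> even j" for i j
    using that by (auto simp: N_def N_even_mat_index)
  have inv: "(\<Sum>k\<le>l. y (l - k) * z k) = (if l = 0 then 1 else 0)" for l
    unfolding z_def by (rule xstar_convolution_inverse) (rule y0)
  \<comment> \<open>The bound \<open>M\<close> stays free: it is \<open>m\<close> for even
    \<open>i\<close> and \<open>m - 1\<close> for odd \<open>i\<close>.\<close>
  have conv: "(\<Sum>k\<le>M. (if k \<le> p then y (p - k) else 0) * (if q \<le> k then z (k - q) else 0))
      = (if p = q then 1 else 0)" if "p \<le> M" for p q M
  proof (cases "q \<le> p")
    case True
    show ?thesis
      unfolding sum_window_convolution[OF True that] inv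
      using True by auto
  qed (auto intro!: sum.neutral)
  have split: "(\<Sum>k<n-1. N $$ (k, i) * N $$ (Suc k, j))
      = (\<Sum>k\<le>m. N $$ (2 * k, i) * N $$ (Suc (2 * k), j))
      + (\<Sum>k<m. N $$ (Suc (2 * k), i) * N $$ (Suc (Suc (2 * k)), j))" for i j
    using sum_lessThan_odd_split[of "\<lambda>k. N $$ (k, i) * N $$ (Suc k, j)" m] m by simp
  have "(\<Sum>k<n-1. N $$ (k, i) * N $$ (Suc k, j)) = (if j = Suc i then 1 else 0)"
    if ij: "i < n" "j < n" for i j
  proof (cases "even i"; cases "even j")
    assume p: "even i" "\<not> even j"
    obtain p q where pq: "i = 2 * p" "j = Suc (2 * q)" using p by (auto elim!: evenE oddE)
    have pqm: "p \<le> m" "q \<le> m" using pq ij m by auto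
    have "(\<Sum>k\<le>m. N $$ (2 * k, i) * N $$ (Suc (2 * k), j)) = (if p = q then 1 else 0)"
      unfolding conv[OF pqm(1), symmetric] pq using ee oo pqm by (intro sum.cong) auto
    moreover have "(\<Sum>k<m. N $$ (Suc (2 * k), i) * N $$ (Suc (Suc (2 * k)), j)) = 0"
      using eo ij m p by (intro sum.neutral) auto
    ultimately show ?thesis unfolding split using pq by auto
  next
    assume p: "\<not> even i" "even j"
    obtain p q where pq: "i = Suc (2 * p)" "j = 2 * q" using p by (auto elim!: evenE oddE)
    have pqm: "p \<le> m" "q \<le> m" using pq ij m by auto
    have "(\<Sum>k\<le>m. N $$ (2 * k, i) * N $$ (Suc (2 * k), j)) = 0"
      using eo ij m p by (intro sum.neutral) auto
    moreover have "(\<Sum>k<m. N $$ (Suc (2 * k), i) * N $$ (Suc (Suc (2 * k)), j)) = (if q = Suc p then 1 else 0)"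
    \<comment> \<open>The right factor sits in row \<open>2 * (k + 1)\<close>, so the upper window
      ends at \<open>q - 1\<close>; column 0 has only zeros in these rows.\<close>
    proof (cases q)
      case 0
      have "N $$ (Suc (Suc (2 * k)), j) = 0" if "k < m" for k
        using ee[of "Suc k" q] that pq 0 by simp
      then show ?thesis using 0 by simp
    next
      case (Suc r)
      obtain M where M: "m = Suc M" using pqm Suc by (cases m) auto
      have "(\<Sum>k<m. N $$ (Suc (2 * k), i) * N $$ (Suc (Suc (2 * k)), j))
          = (\<Sum>k\<le>M. (if k \<le> r then y (r - k) else 0) * (if p \<le> k then z (k - p) else 0))"
        unfolding M lessThan_Suc_atMost
      proof (intro sum.cong refl)
        fix k assume "k \<in> {..M}"
        then show "N $$ (Suc (2 * k), i) * N $$ (Suc (Suc (2 * k)), j)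
            = (if k \<le> r then y (r - k) else 0) * (if p \<le> k then z (k - p) else 0)"
          using oo[of k p] ee[of "Suc k" q] M pq pqm Suc by simp
      qed
      also have "\<dots> = (if r = p then 1 else 0)" using M Suc pqm by (intro conv) simp
      finally show ?thesis using Suc by simp
    qed
    ultimately show ?thesis unfolding split using pq by auto
  next
    assume p: "even i" "even j"
    have "(\<Sum>k<n-1. N $$ (k, i) * N $$ (Suc k, j)) = 0"
    proof (intro sum.neutral ballI)
      fix k assume "k \<in> {..<n-1}"
      then show "N $$ (k, i) * N $$ (Suc k, j) = 0"
        using eo[of k i] eo[of "Suc k" j] ij p by (cases "even k") auto
    qed
    then show ?thesis using p by auto
  next
    assume p: "\<not> even i" "\<not> even j"
    have "(\<Sum>k<n-1. N $$ (k, i) * N $$ (Suc k, j)) = 0"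
    proof (intro sum.neutral ballI)
      fix k assume "k \<in> {..<n-1}"
      then show "N $$ (k, i) * N $$ (Suc k, j) = 0"
        using eo[of k i] eo[of "Suc k" j] ij p by (cases "even k") auto
    qed
    then show ?thesis using p by auto
  qed
  then show ?thesis
    unfolding mem_Sol_iff NN by (auto simp: N_def N_even_mat_def mat1_def)
qed

text \<open>The first row gives the upper block \<open>p\<close>, the second column the lower block
  \<open>q\<close>. The equation at \<open>(2 * l, 1)\<close> makes their series reciprocal, and
  uniqueness of the reciprocal identifies \<open>q\<close> with the sequence built from
  \<open>xstar\<close>.\<close>

lemma Sol_even_eq_N_even_mat:
  assumes n: "n \<ge> 2" "even n" and X: "X \<in> carrier (Sol n)" and X0: "X $$ (0, 0) = 1"
  shows "X = N_even_mat n (\<lambda>l. X $$ (0, 2 * l))"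
proof -
  define p where "p l = X $$ (0, 2 * l)" for l
  define q where "q l = X $$ (Suc (2 * l), 1)" for l
  have "even (n - 2)" using n by simp
  then obtain m where "n - 2 = 2 * m" by (blast elim: evenE)
  then have m: "n = Suc (Suc (2 * m))" using n by simp
  have p0: "p 0 = 1" using X0 by (simp add: p_def)
  have diag: "X $$ (i, i) = 1" if "i < n" for i
    using Sol_diag[OF n(1) X that] Sol_diag_mult[OF n(1) X] X0 by simp
  \<comment> \<open>For even \<open>n\<close> the four zero lemmas together clear every position of
    mixed parity.\<close>
  have off: "X $$ (i, j) = 0" if "i < n" "j < n" "even i \<noteq> even j" for i j
  proof (cases "even i")
    case True
    then have "even (n - i)" "even (n - Suc j)" using n that by auto
    then show ?thesis
      using that Sol_row_left[OF n(1) X] Sol_col_above[OF n(1) X] by (metis linorder_neqE_nat)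
  next
    case False
    then show ?thesis
      using that Sol_odd_row_right[OF n(1) X] Sol_even_col_below[OF n(1) X] by (metis linorder_neqE_nat)
  qed
  have pX: "X $$ (i, j) = p ((j - i) div 2)" if "i \<le> j" "j < n" "even i" "even j" for i j
    using that Sol_shift[OF n(1) X, of 0 "i div 2" "j - i"] by (simp add: p_def)
  have qX: "X $$ (i, j) = q ((i - j) div 2)" if "j \<le> i" "i < n" "odd i" "odd j" for i j
  proof -
    obtain k where k: "j = 2 * k + 1" using \<open>odd j\<close> by (blast elim: oddE)
    then show ?thesis using that Sol_shift[OF n(1) X, of "i - 2 * k" k 1] by (simp add: q_def Suc_diff_Suc)
  qed
  have "q l = (if l = 0 then 1 else xstar p l - p l)" if "l \<le> m" for l
    using p0 _ that
  proof (rule convolution_left_cancel)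
    fix l assume l: "l \<le> m"
    have "(\<Sum>k\<le>l. p (l - k) * q k) = (\<Sum>k\<le>m. X $$ (2 * k, 2 * l) * X $$ (Suc (2 * k), 1))"
    proof (intro sum.mono_neutral_cong_left ballI)
      fix k assume "k \<in> {..m} - {..l}"
      then show "X $$ (2 * k, 2 * l) * X $$ (Suc (2 * k), 1) = 0"
        using Sol_even_col_below[OF n(1) X, of "2 * l" "2 * k"] m by simp
    next
      fix k assume "k \<in> {..l}"
      then show "p (l - k) * q k = X $$ (2 * k, 2 * l) * X $$ (Suc (2 * k), 1)"
        using pX[of "2 * k" "2 * l"] l m by (simp add: q_def flip: diff_mult_distrib2)
    qed (use l in auto)
    also have "\<dots> = (\<Sum>k<n-1. X $$ (k, 2 * l) * X $$ (Suc k, 1))"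
    proof -
      have "(\<Sum>k<m. X $$ (Suc (2 * k), 2 * l) * X $$ (Suc (Suc (2 * k)), 1)) = 0"
        using off l m by (intro sum.neutral) auto
      then show ?thesis
        using sum_lessThan_odd_split[of "\<lambda>k. X $$ (k, 2 * l) * X $$ (Suc k, 1)" m] m by simp
    qed
    also have "\<dots> = (if l = 0 then 1 else 0)"
      using X l m by (simp add: mem_Sol_iff)
    finally show "(\<Sum>k\<le>l. p (l - k) * q k) = (\<Sum>k\<le>l. p (l - k) * (if k = 0 then 1 else xstar p k - p k))"
      by (simp only: xstar_convolution_inverse[of p, OF p0])
  qed
  then have q: "q l = xstar p l - p l" if "0 < l" "l \<le> m" for l using that by simp
  have "X = N_even_mat n p"
  proof (rule eq_matI)
    fix i j assume "i < dim_row (N_even_mat n p)" "j < dim_col (N_even_mat n p)"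
    then have ij: "i < n" "j < n" by (auto simp: N_even_mat_def mat1_def)
    consider "i = j" | "even i \<noteq> even j" | "i < j" "even i" "even j" | "j < i" "even i" "even j"
      | "i < j" "odd i" "odd j" | "j < i" "odd i" "odd j"
      by (metis linorder_neqE_nat)
    then show "X $$ (i, j) = N_even_mat n p $$ (i, j)"
    proof cases
      case 6
      then obtain a b where "i = 2 * a + 1" "j = 2 * b + 1" by (blast elim: oddE)
      then have "0 < (i - j) div 2" "(i - j) div 2 \<le> m" using 6 ij m by auto
      then show ?thesis using 6 ij qX[of j i] q by (simp add: N_even_mat_index)
    next
      case 3 then show ?thesis using ij pX[of i j] by (simp add: N_even_mat_index)
    next
      case 4 then show ?thesis using ij Sol_even_col_below[OF n(1) X, of j i] by (simp add: N_even_mat_index)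
    next
      case 5 then show ?thesis using ij Sol_odd_row_right[OF n(1) X, of i j] by (simp add: N_even_mat_index)
    qed (use ij diag off in \<open>auto simp: N_even_mat_index\<close>)
  qed (use X in \<open>auto simp: Sol_def N_even_mat_def mat1_def\<close>)
  then show ?thesis by (simp only: p_def [abs_def])
qed

text \<open>Both parities receive one description, in which \<open>N\<close> is the kernel of the
  corner entry.\<close>

lemma N_set_eq:
  assumes n: "n \<ge> 2"
  shows "N_set n = {X \<in> carrier (Sol n). X $$ (0, 0) = 1}"
proof (cases "odd n")
  case True
  have "N_odd_mat n x $$ (0, 0) = 1" for x using n by (simp add: N_odd_mat_index)
  then show ?thesis
    using True N_odd_mat_in_Sol[OF True] Sol_odd_eq_N_odd_mat[OF n True]
    by (auto simp: N_set_def)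
next
  case False
  then have e: "even n" by simp
  have "N_even_mat n x $$ (0, 0) = 1" for x using n by (simp add: N_even_mat_index)
  then show ?thesis
    using e N_even_mat_in_Sol[OF n e] Sol_even_eq_N_even_mat[OF n e]
    by (auto simp: N_set_def)
qed

section \<open>The corner entry and its section\<close>

definition complex_units :: "complex monoid" where
  "complex_units = \<lparr>carrier = - {0}, monoid.mult = (*), one = 1\<rparr>"

lemma complex_units_group: "group complex_units"
  by (rule groupI) (auto simp: complex_units_def intro!: bexI[of _ "inverse _"])

definition alternating_diag :: "nat \<Rightarrow> complex \<Rightarrow> complex mat" where
  "alternating_diag n c = mat1 n (\<lambda>i j. if i = j then (if odd i then c else inverse c) else 0)"

lemma alternating_diag_index:
  assumes "i < n" "j < n"
  shows "alternating_diag n c $$ (i, j) = (if i = j then (if even i then c else inverse c) else 0)"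
  using assms by (simp add: alternating_diag_def mat1_def)

lemma alternating_diag_carrier: "alternating_diag n c \<in> carrier_mat n n"
  by (simp add: alternating_diag_def mat1_def)

lemma D_set_eq: "D_set n = alternating_diag n ` carrier complex_units"
  by (auto simp: D_set_def alternating_diag_def complex_units_def)

text \<open>Neighbouring diagonal entries are \<open>c\<close> and \<open>inverse c\<close>, with
  product 1.\<close>

lemma alternating_diag_in_Sol:
  assumes "c \<noteq> 0"
  shows "alternating_diag n c \<in> carrier (Sol n)"
proof -
  let ?D = "alternating_diag n c"
  have "(\<Sum>k<n-1. ?D $$ (k, i) * ?D $$ (Suc k, j)) = (if j = Suc i then 1 else 0)"
    if ij: "i < n" "j < n" for i j
  proof -
    have "(\<Sum>k<n-1. ?D $$ (k, i) * ?D $$ (Suc k, j))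
        = (\<Sum>k<n-1. if k = i then if j = Suc i then 1 else 0 else 0)"
      using ij assms by (intro sum.cong) (auto simp: alternating_diag_index)
    also have "\<dots> = (if j = Suc i then 1 else 0)" using ij by (auto simp: sum.delta)
    finally show ?thesis .
  qed
  then show ?thesis by (simp add: mem_Sol_iff alternating_diag_carrier)
qed

lemma alternating_diag_mult:
  "alternating_diag n (c * d) = alternating_diag n c * alternating_diag n d"
proof (rule eq_matI)
  fix i j assume "i < dim_row (alternating_diag n c * alternating_diag n d)"
    "j < dim_col (alternating_diag n c * alternating_diag n d)"
  then have ij: "i < n" "j < n" by (auto simp: alternating_diag_def mat1_def)
  have "(alternating_diag n c * alternating_diag n d) $$ (i, j)
      = (\<Sum>k<n. alternating_diag n c $$ (i, k) * alternating_diag n d $$ (k, j))"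
    using ij alternating_diag_carrier[of n]
    by (auto simp: scalar_prod_def atLeast0LessThan alternating_diag_def mat1_def intro!: sum.cong)
  also have "\<dots> = (\<Sum>k<n. if k = i then alternating_diag n (c * d) $$ (i, j) else 0)"
    using ij by (intro sum.cong) (auto simp: alternating_diag_index)
  also have "\<dots> = alternating_diag n (c * d) $$ (i, j)" using ij by simp
  finally show "alternating_diag n (c * d) $$ (i, j) = (alternating_diag n c * alternating_diag n d) $$ (i, j)" ..
qed (auto simp: alternating_diag_def mat1_def)

text \<open>The first basis vector is a common eigenvector of all solutions, and the corner entry is
  its eigenvalue.\<close>

lemma Sol_corner_mult:
  assumes n: "n \<ge> 2" and X: "X \<in> carrier (Sol n)" and Y: "Y \<in> carrier (Sol n)"
  shows "(X * Y) $$ (0, 0) = X $$ (0, 0) * Y $$ (0, 0)"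
proof -
  have c: "X \<in> carrier_mat n n" "Y \<in> carrier_mat n n" using X Y by (auto simp: Sol_def)
  obtain m where m: "n = Suc m" using n by (cases n) auto
  have "(X * Y) $$ (0, 0) = (\<Sum>k<n. X $$ (0, k) * Y $$ (k, 0))"
    using c n by (auto simp: scalar_prod_def atLeast0LessThan intro!: sum.cong)
  also have "\<dots> = X $$ (0, 0) * Y $$ (0, 0)"
    using Sol_first_col[OF n Y] by (simp add: m sum.lessThan_Suc_shift del: sum.lessThan_Suc)
  finally show ?thesis .
qed

theorem theorem4p9:
  fixes n :: nat
  assumes "n \<ge> 2"
  shows "N_set n \<lhd> Sol n \<and>
         internal_semidirect (Sol n) (N_set n) (D_set n) \<and>
         Sol n \<cong> conj_semidirect_product (Sol n) (N_set n) (D_set n)"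
proof -
  interpret group "Sol n" using assms by (rule Sol_group)
  let ?\<pi> = "\<lambda>X. X $$ (0, 0)"
  have "X $$ (0, 0) \<noteq> 0" if "X \<in> carrier (Sol n)" for X
    using Sol_diag_mult[OF assms that] by auto
  then have \<pi>: "group_hom (Sol n) complex_units ?\<pi>"
    using Sol_corner_mult[OF assms] complex_units_group is_group
    by (auto simp: group_hom_def group_hom_axioms_def complex_units_def Sol_def intro!: homI)
  have s: "group_hom complex_units (Sol n) (alternating_diag n)"
    using alternating_diag_in_Sol alternating_diag_mult complex_units_group is_group
    by (auto simp: group_hom_def group_hom_axioms_def complex_units_def Sol_def intro!: homI)
  have ker: "kernel (Sol n) complex_units ?\<pi> = N_set n"
    by (simp add: kernel_def N_set_eq[OF assms] complex_units_def)
  \<comment> \<open>The section \<open>alternating_diag n\<close> splits the corner map, so its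
    image \<open>D\<close> complements the kernel \<open>N\<close>.\<close>
  have sd: "internal_semidirect (Sol n) (N_set n) (D_set n)"
    unfolding ker[symmetric] D_set_eq using assms
    by (intro split_extension_internal_semidirect[OF \<pi> s]) (simp add: alternating_diag_index)
  then show ?thesis
    using internal_semidirect_imp_iso[OF sd] by (simp add: internal_semidirect_def)
qed

end
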